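(* Let $\nu$ be a lattice path and let $\mathtt{sch}_\nu(i)$ denote the number of $\nu$-Schröder paths with exactly $i$ diagonal steps. Then $$\sum_{i\geq 0} (-1)^i\,\mathtt{sch}_\nu(i) = 1.$$
   Context: A lattice path from $(0,0)$ to $(b,a)\in\mathbb{Z}_{\ge 0}^2$ is a sequence of $a$ north steps $N=(0,1)$ and $b$ east steps $E=(1,0)$. For such a path $\nu$, a $\nu$-Schröder path is a path from $(0,0)$ to $(b,a)$ with steps $N=(0,1)$, $E=(1,0)$, $D=(1,1)$ (diagonal) which stays weakly above $\nu$. *)

theory Defs
  imports "HOL-Analysis.Analysis"
begin

datatype step = North | East | Diagonal

fun step_vec :: "step \<Rightarrow> real \<times> real" where
  "step_vec North = (0, 1)"
| "step_vec East = (1, 0)"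
| "step_vec Diagonal = (1, 1)"

definition vertex :: "step list \<Rightarrow> nat \<Rightarrow> real \<times> real" where
  "vertex p k = sum_list (map step_vec (take k p))"

definition endpoint :: "step list \<Rightarrow> real \<times> real" where
  "endpoint p = vertex p (length p)"

(* The path as a polygonal curve in the plane. The origin is inserted explicitly so that
   the empty path traces the single point (0,0). *)
definition curve :: "step list \<Rightarrow> (real \<times> real) set" where
  "curve p = insert (0, 0) (\<Union>k<length p. closed_segment (vertex p k) (vertex p (Suc k)))"

definition lattice_path :: "nat \<times> nat \<Rightarrow> step list \<Rightarrow> bool" where
  "lattice_path = (\<lambda>(b, a) p.
     set p \<subseteq> {North, East} \<and> count_list p North = a \<and> count_list p East = b)"

(* Every point of the curve of p, not merely every vertex, must lie on or vertically above
   some point of the curve of q. Testing vertices alone would be too permissive: a diagonal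
   step cutting below a corner North, East of q has both its endpoints on q. Where q has a
   vertical segment, its lowest point is the relevant bound. *)
definition weakly_above :: "step list \<Rightarrow> step list \<Rightarrow> bool" where
  "weakly_above p q \<longleftrightarrow> (\<forall>(x, y) \<in> curve p. \<exists>y' \<le> y. (x, y') \<in> curve q)"

definition schroeder_path :: "step list \<Rightarrow> step list \<Rightarrow> bool" where
  "schroeder_path \<nu> p \<longleftrightarrow> endpoint p = endpoint \<nu> \<and> weakly_above p \<nu>"

definition sch :: "step list \<Rightarrow> nat \<Rightarrow> nat" where
  "sch \<nu> i = card {p. schroeder_path \<nu> p \<and> count_list p Diagonal = i}"

(* The sets counted by sch are finite, so card is the genuine number of paths. *)
lemma finite_schroeder_paths: "finite {p. schroeder_path \<nu> p}"
proof -
  have len: "real (length p) \<le> fst (sum_list (map step_vec p)) + snd (sum_list (map step_vec p))"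
    for p
  proof (induction p)
    case Nil
    show ?case by simp
  next
    case (Cons s p)
    then show ?case by (cases s) auto
  qed
  define n where "n = nat \<lceil>fst (endpoint \<nu>) + snd (endpoint \<nu>)\<rceil>"
  have UNIV_step: "(UNIV :: step set) = {North, East, Diagonal}"
    using step.exhaust by blast
  have "{p. schroeder_path \<nu> p} \<subseteq> {p. set p \<subseteq> UNIV \<and> length p \<le> n}"
  proof
    fix p assume "p \<in> {p. schroeder_path \<nu> p}"
    then have "sum_list (map step_vec p) = endpoint \<nu>"
      by (simp add: schroeder_path_def endpoint_def vertex_def)
    with len[of p] have "real (length p) \<le> fst (endpoint \<nu>) + snd (endpoint \<nu>)" by simp
    then show "p \<in> {p. set p \<subseteq> UNIV \<and> length p \<le> n}"
      unfolding n_def by simp linarith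
  qed
  moreover have "finite {p :: step list. set p \<subseteq> UNIV \<and> length p \<le> n}"
    by (rule finite_lists_length_le) (simp add: UNIV_step)
  ultimately show ?thesis by (rule finite_subset)
qed

end

theory Submission imports Defs begin

text \<open>
  The signed count, with sign given by the parity of the number of diagonal steps, of the admissible
  paths from any lattice point on or above \<open>\<nu>\<close> to the endpoint of \<open>\<nu>\<close> equals 1, by induction on the
  distance to the endpoint. Since \<open>\<nu>\<close> is horizontal over the interior of each column, an east step
  from a point is admissible iff the diagonal step from it is, so these two contributions cancel
  and only the north step remains; at maximal height only the east step remains.
\<close>

section \<open>Endpoints of step lists\<close>

lemma endpoint_Nil [simp]: "endpoint [] = 0"
  by (simp add: endpoint_def vertex_def)

lemma endpoint_Cons [simp]: "endpoint (s # p) = step_vec s + endpoint p"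
  by (simp add: endpoint_def vertex_def)

lemma endpoint_nonneg: "0 \<le> fst (endpoint p)" "0 \<le> snd (endpoint p)"
proof (induction p)
  case (Cons s p)
  case 1 then show ?case using Cons by (cases s) auto
  case 2 then show ?case using Cons by (cases s) auto
qed auto

text \<open>No step lowers a coordinate and each raises at least one. This settles the base case of
  the induction, where start and target coincide.\<close>

lemma endpoint_eq_0_iff: "endpoint p = 0 \<longleftrightarrow> p = []"
proof (cases p)
  case (Cons s q)
  then show ?thesis
    using endpoint_nonneg[of q] by (cases s; cases "endpoint q") (auto simp: zero_prod_def)
qed auto

lemma endpoint_lattice_path:
  assumes "lattice_path (b, a) p"
  shows "endpoint p = (real b, real a)"
  using assms
proof (induction p arbitrary: a b)
  case (Cons s p)
  show ?case
  proof (cases s)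
    case North
    then have "lattice_path (b, a - 1) p" "a \<ge> 1" using Cons.prems by (auto simp: lattice_path_def)
    then show ?thesis using Cons.IH North by (auto simp: of_nat_diff)
  next
    case East
    then have "lattice_path (b - 1, a) p" "b \<ge> 1" using Cons.prems by (auto simp: lattice_path_def)
    then show ?thesis using Cons.IH East by (auto simp: of_nat_diff)
  next
    case Diagonal
    then show ?thesis using Cons.prems by (auto simp: lattice_path_def)
  qed
qed (auto simp: lattice_path_def zero_prod_def)

section \<open>Curves of step lists and the region above them\<close>

lemma curve_Nil [simp]: "curve [] = {0}"
  by (simp add: curve_def zero_prod_def)

lemma curve_Cons:
  "curve (s # p) = closed_segment 0 (step_vec s) \<union> (+) (step_vec s) ` curve p"
proof -
  have v: "vertex (s # p) 0 = 0" "vertex (s # p) (Suc k) = step_vec s + vertex p k" for k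
    by (simp_all add: vertex_def)
  have "(\<Union>k<length (s # p). closed_segment (vertex (s # p) k) (vertex (s # p) (Suc k)))
      = closed_segment 0 (step_vec s) \<union>
        (\<Union>k<length p. (+) (step_vec s) ` closed_segment (vertex p k) (vertex p (Suc k)))"
    by (simp only: length_Cons lessThan_Suc_eq_insert_0 UN_insert image_image v closed_segment_translation
        UN_simps)
       (simp add: vertex_def)
  moreover have "curve q = insert 0 (\<Union>k<length q. closed_segment (vertex q k) (vertex q (Suc k)))" for q
    by (simp add: curve_def zero_prod_def)
  \<comment> \<open>Both inserted origins are absorbed: that of \<open>s # p\<close> starts the
    first segment, and the translate of that of \<open>p\<close> ends it.\<close>
  ultimately show ?thesis
    by (simp add: image_UN insert_absorb Un_commute)
qed

lemma zero_in_curve: "0 \<in> curve p"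
  by (simp add: curve_def zero_prod_def)

lemma closed_segment_step:
  "closed_segment v (v + step_vec s) = (\<lambda>t. v + t *\<^sub>R step_vec s) ` {0..1}"
  by (auto simp: in_segment image_iff Bex_def algebra_simps)

lemma closed_segment_step_coords:
  fixes x y :: real
  shows "closed_segment (x, y) (x, y + 1) = (\<lambda>t. (x, y + t)) ` {0..1}"
    and "closed_segment (x, y) (x + 1, y) = (\<lambda>t. (x + t, y)) ` {0..1}"
    and "closed_segment (x, y) (x + 1, y + 1) = (\<lambda>t. (x + t, y + t)) ` {0..1}"
    and "closed_segment 0 (0, 1::real) = Pair (0::real) ` {0..1}"
    and "closed_segment 0 (1::real, 0) = (\<lambda>t. (t, 0::real)) ` {0..1}"
  using closed_segment_step[of "(x, y)" North] closed_segment_step[of "(x, y)" East]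
    closed_segment_step[of "(x, y)" Diagonal] closed_segment_step[of 0 North]
    closed_segment_step[of 0 East]
  by simp_all

text \<open>North steps have integer abscissa, so over an open column only an east step can occur,
  and it crosses the whole column at integer height. Strict bounds on \<open>u\<close> exclude the
  vertical segments. The column index is an \<open>int\<close> because dropping a first east step
  shifts it to \<open>i - 1\<close>, possibly negative.\<close>

lemma lattice_path_horizontal:
  fixes i :: int and u y :: real
  assumes "set p \<subseteq> {North, East}" "(u, y) \<in> curve p" "i < u" "u < i + 1"
  shows "y \<in> \<int> \<and> (\<forall>t::real. i \<le> t \<and> t \<le> i + 1 \<longrightarrow> (t, y) \<in> curve p)"
  using assms
proof (induction p arbitrary: i u y)
  case Nil
  then show ?case by (auto simp: zero_prod_def)
next
  case (Cons s p)
  from Cons.prems(2) consider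
      (first) "(u, y) \<in> closed_segment 0 (step_vec s)"
    | (rest) "(u, y) \<in> (+) (step_vec s) ` curve p"
    by (auto simp: curve_Cons)
  then show ?case
  proof cases
    case first
    then obtain t where t: "0 \<le> t" "t \<le> 1" "(u, y) = t *\<^sub>R step_vec s"
      using closed_segment_step[of 0 s] by auto
    \<comment> \<open>A north segment would give u = 0, which is never strictly between consecutive
      integers.\<close>
    with Cons.prems have s: "s = East" by auto
    with t have "y = 0" "u = t" by auto
    with Cons.prems t have "i = 0" by linarith
    then show ?thesis using s \<open>y = 0\<close> by (auto simp: curve_Cons closed_segment_step_coords)
  next
    case rest
    then obtain u' y' where c: "(u', y') \<in> curve p" "(u, y) = step_vec s + (u', y')" by auto
    from Cons.prems have s: "s = North \<or> s = East" by auto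
    then show ?thesis
    proof
      assume s: "s = North"
      with c Cons.prems Cons.IH[of u' y' i]
      have IH: "y' \<in> \<int>" "\<forall>t::real. i \<le> t \<and> t \<le> i + 1 \<longrightarrow> (t, y') \<in> curve p" by auto
      have "(t, y) \<in> (+) (step_vec s) ` curve p" if "i \<le> t" "t \<le> i + 1" for t :: real
        using that IH s c(2) by (intro image_eqI[of _ _ "(t, y')"]) auto
      then show ?thesis using IH s c by (auto simp: curve_Cons)
    next
      assume s: "s = East"
      with c Cons.prems Cons.IH[of u' y' "i - 1"]
      have IH: "y' \<in> \<int>" "\<forall>t::real. i - 1 \<le> t \<and> t \<le> i \<longrightarrow> (t, y') \<in> curve p" by auto
      have "(t, y) \<in> (+) (step_vec s) ` curve p" if "i \<le> t" "t \<le> i + 1" for t :: real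
        using that IH s c(2) by (intro image_eqI[of _ _ "(t - 1, y')"]) auto
      then show ?thesis using IH s c by (auto simp: curve_Cons)
    qed
  qed
qed

text \<open>Needed at maximal height, where no north step is left: it puts the whole top edge y = a
  into the region above the path, so an east step there is always admissible.\<close>

lemma lattice_path_curve_over:
  assumes "lattice_path (b, a) p" "0 \<le> t" "t \<le> real b"
  shows "\<exists>y \<le> real a. (t, y) \<in> curve p"
  using assms
proof (induction p arbitrary: a b t)
  case Nil
  then show ?case by (auto simp: lattice_path_def zero_prod_def)
next
  case (Cons s p)
  show ?case
  proof (cases s)
    case North
    then have "lattice_path (b, a - 1) p" "a \<ge> 1" using Cons.prems by (auto simp: lattice_path_def)
    with Cons.IH[of b "a - 1" t] Cons.prems obtain y where "y \<le> real a - 1" "(t, y) \<in> curve p"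
      by (auto simp: of_nat_diff)
    then have "1 + y \<le> a" "(t, 1 + y) \<in> curve (s # p)"
      using North by (auto simp: curve_Cons intro!: image_eqI[of _ _ "(t, y)"])
    then show ?thesis by blast
  next
    case East
    then have p: "lattice_path (b - 1, a) p" "b \<ge> 1" using Cons.prems by (auto simp: lattice_path_def)
    show ?thesis
    proof (cases "t \<le> 1")
      case True
      then have "(t, 0) \<in> curve (s # p)"
        using East Cons.prems by (auto simp: curve_Cons closed_segment_step_coords)
      then show ?thesis by (intro exI[of _ 0]) auto
    next
      case False
      with Cons.IH[of "b - 1" a "t - 1"] Cons.prems p obtain y where
        "y \<le> real a" "(t - 1, y) \<in> curve p" by (auto simp: of_nat_diff)
      then have "y \<le> a" "(t, y) \<in> curve (s # p)"
        using East by (auto simp: curve_Cons intro!: image_eqI[of _ _ "(t - 1, y)"])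
      then show ?thesis by blast
    qed
  next
    case Diagonal
    then show ?thesis using Cons.prems by (auto simp: lattice_path_def)
  qed
qed

text \<open>Turns \<open>weakly_above\<close> into containment of a curve in a fixed set, a
  condition that can be checked one segment at a time.\<close>

definition region_above :: "step list \<Rightarrow> (real \<times> real) set" where
  "region_above q = {(x, y). \<exists>y' \<le> y. (x, y') \<in> curve q}"

lemma region_above_upward:
  "(x, y) \<in> region_above q \<Longrightarrow> y \<le> z \<Longrightarrow> (x, z) \<in> region_above q"
  unfolding region_above_def by (auto intro: order_trans)

text \<open>The diagonal segment lies over the east segment and the region is closed upward.
  Conversely, one interior point of the diagonal suffices, since the height of \<open>q\<close>
  found there is available across the whole closed column.\<close>

lemma east_admissible_iff_diagonal:
  fixes x y :: int
  defines "v \<equiv> (real_of_int x, real_of_int y)"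
  assumes "set q \<subseteq> {North, East}"
  shows "closed_segment v (v + step_vec East) \<subseteq> region_above q \<longleftrightarrow>
    closed_segment v (v + step_vec Diagonal) \<subseteq> region_above q"
    (is "?E \<longleftrightarrow> ?D")
proof
  assume ?E
  then have "(real_of_int x + t, real_of_int y) \<in> region_above q" if "0 \<le> t" "t \<le> 1" for t
    using that by (auto simp: v_def closed_segment_step_coords)
  then have "(real_of_int x + t, real_of_int y + t) \<in> region_above q" if "0 \<le> t" "t \<le> 1" for t
    using that by (intro region_above_upward[of _ y _ "y + t"]) auto
  then show ?D
    by (auto simp: v_def closed_segment_step_coords)
next
  assume ?D
  \<comment> \<open>The midpoint is strictly inside the column, so \<open>q\<close> has integer
    height below it, and an integer at most y + 1/2 is at most y.\<close>
  have "(x + 1/2, y + 1/2) \<in> closed_segment v (v + step_vec Diagonal)"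
    by (auto simp: v_def closed_segment_step_coords)
  with \<open>?D\<close> obtain y' where y': "y' \<le> y + 1/2" "(x + 1/2, y') \<in> curve q"
    by (auto simp: region_above_def)
  with lattice_path_horizontal[OF assms(2) y'(2), of x]
  have h: "y' \<in> \<int>" "\<And>t::real. x \<le> t \<Longrightarrow> t \<le> x + 1 \<Longrightarrow> (t, y') \<in> curve q" by auto
  from h(1) y'(1) have "y' \<le> y" by (auto elim!: Ints_cases)
  then show ?E
    using h(2) by (auto simp: v_def closed_segment_step_coords region_above_def)
qed

section \<open>Paths confined to a region, split by their first step\<close>

definition paths_in :: "(real \<times> real) set \<Rightarrow> real \<times> real \<Rightarrow> real \<times> real \<Rightarrow> step list set" where
  "paths_in A w v = {p. v + endpoint p = w \<and> (+) v ` curve p \<subseteq> A}"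

definition signed_count :: "step list set \<Rightarrow> int" where
  "signed_count P = (\<Sum>p\<in>P. (-1) ^ count_list p Diagonal)"

lemma paths_in_self: "v \<in> A \<Longrightarrow> paths_in A v v = {[]}"
  by (auto simp: paths_in_def endpoint_eq_0_iff)

lemma paths_in_empty:
  assumes "fst v > fst w \<or> snd v > snd w"
  shows "paths_in A w v = {}"
proof -
  have "v + endpoint p \<noteq> w" for p
    using assms endpoint_nonneg[of p] by (auto simp: prod_eq_iff)
  then show ?thesis by (simp add: paths_in_def)
qed

text \<open>Translating the curve of the remaining steps amounts to moving their starting point, so
  admissibility of the first segment and of the rest are separate conditions.\<close>

lemma Cons_in_paths_in:
  "s # p \<in> paths_in A w v \<longleftrightarrow>
     closed_segment v (v + step_vec s) \<subseteq> A \<and> p \<in> paths_in A w (v + step_vec s)"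
proof -
  have "closed_segment v (v + step_vec s) = (+) v ` closed_segment 0 (step_vec s)"
    by (metis add.right_neutral closed_segment_translation)
  then show ?thesis
    by (auto simp: paths_in_def curve_Cons image_Un image_image algebra_simps)
qed

definition paths_via :: "(real \<times> real) set \<Rightarrow> real \<times> real \<Rightarrow> real \<times> real \<Rightarrow> step \<Rightarrow> step list set" where
  "paths_via A w v s =
     (if closed_segment v (v + step_vec s) \<subseteq> A then paths_in A w (v + step_vec s) else {})"

lemma paths_in_step:
  assumes "v \<noteq> w"
  shows "paths_in A w v = (#) North ` paths_via A w v North \<union> (#) East ` paths_via A w v East \<union>
    (#) Diagonal ` paths_via A w v Diagonal" (is "_ = ?R")
proof (rule set_eqI)
  fix p
  show "p \<in> paths_in A w v \<longleftrightarrow> p \<in> ?R"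
  proof (cases p)
    case Nil
    then show ?thesis using assms by (auto simp: paths_in_def)
  next
    case (Cons s p')
    then show ?thesis by (cases s) (auto simp: Cons_in_paths_in paths_via_def)
  qed
qed

text \<open>Prefixing a diagonal step flips the parity, hence the minus sign. Additivity over the
  three disjoint families requires finiteness, as a sum over an infinite set is 0 by
  convention.\<close>

lemma signed_count_step:
  assumes "v \<noteq> w" "\<And>s. finite (paths_via A w v s)"
  shows "signed_count (paths_in A w v) = signed_count (paths_via A w v North)
    + signed_count (paths_via A w v East) - signed_count (paths_via A w v Diagonal)"
proof -
  have inj: "inj_on ((#) s) P" for s :: step and P by (auto simp: inj_on_def)
  show ?thesis
    unfolding signed_count_def paths_in_step[OF assms(1)]
    by (subst sum.union_disjoint; (auto simp: assms(2))[1])+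
       (simp add: sum.reindex[OF inj] sum_negf)
qed

text \<open>Finiteness is carried through the same induction because the first-step recursion for
  \<open>signed_count\<close> requires it.\<close>

lemma signed_count_paths_in:
  assumes q: "lattice_path (b, a) q" and "x \<le> b" "y \<le> a" "(real x, real y) \<in> region_above q"
  shows "finite (paths_in (region_above q) (real b, real a) (real x, real y)) \<and>
    signed_count (paths_in (region_above q) (real b, real a) (real x, real y)) = 1"
  using assms(2-)
proof (induction "(b - x) + (a - y)" arbitrary: x y rule: less_induct)
  case less
  let ?A = "region_above q"
  let ?via = "paths_via ?A (real b, real a) (real x, real y)"
  have ne: "set q \<subseteq> {North, East}" using q by (auto simp: lattice_path_def)
  show ?case
  proof (cases "x = b \<and> y = a")
    case True
    then show ?thesis using less.prems by (simp add: paths_in_self signed_count_def)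
  next
    case False
    then have vw: "(real x, real y) \<noteq> (real b, real a)" by auto
    \<comment> \<open>A north step is never blocked, as the region is closed upward; from y = a it
      overshoots the target and has no completion.\<close>
    have N: "finite (?via North) \<and> signed_count (?via North) = (if y < a then 1 else 0)"
    proof (cases "y < a")
      case True
      have "closed_segment (real x, real y) ((real x, real y) + step_vec North) \<subseteq> ?A"
        using less.prems by (auto simp: closed_segment_step_coords intro: region_above_upward)
      moreover have "(real x, real (Suc y)) \<in> ?A"
        using less.prems(3) by (rule region_above_upward) simp
      ultimately show ?thesis
        using less.hyps[of x "Suc y"] less.prems True by (simp add: paths_via_def add.commute)
    qed (simp add: paths_via_def paths_in_empty signed_count_def)
    define ok where "ok s \<longleftrightarrow> closed_segment (real x, real y) ((real x, real y) + step_vec s) \<subseteq> ?A" for s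
    have E: "finite (?via East) \<and>
        signed_count (?via East) = (if x < b \<and> ok East then 1 else 0)"
    proof (cases "x < b \<and> ok East")
      case True
      then have "(real (Suc x), real y) \<in> ?A"
        by (auto simp: ok_def add.commute)
      then show ?thesis
        using less.hyps[of "Suc x" y] less.prems True
        by (auto simp: paths_via_def ok_def add.commute)
    qed (auto simp: paths_via_def ok_def paths_in_empty signed_count_def)
    have D: "finite (?via Diagonal) \<and>
        signed_count (?via Diagonal) = (if x < b \<and> y < a \<and> ok Diagonal then 1 else 0)"
    proof (cases "x < b \<and> y < a \<and> ok Diagonal")
      case True
      then have "(real (Suc x), real (Suc y)) \<in> ?A"
        by (auto simp: ok_def add.commute)
      then show ?thesis
        using less.hyps[of "Suc x" "Suc y"] less.prems True
        by (auto simp: paths_via_def ok_def add.commute)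
    qed (auto simp: paths_via_def ok_def paths_in_empty signed_count_def)
    have fin: "finite (?via s)" for s using N E D by (cases s) auto
    have same: "ok East \<longleftrightarrow> ok Diagonal"
      using east_admissible_iff_diagonal[OF ne, of "int x" "int y"] by (simp add: ok_def)
    have top: "ok East" if "y = a" "x < b"
    proof -
      have "(x + t, real a) \<in> ?A" if "0 \<le> t" "t \<le> 1" for t :: real
        using lattice_path_curve_over[OF q, of "x + t"] that \<open>x < b\<close>
        by (auto simp: region_above_def)
      then show ?thesis using \<open>y = a\<close> by (auto simp: ok_def closed_segment_step_coords)
    qed
    have "finite (paths_in ?A (real b, real a) (real x, real y))"
      using paths_in_step[OF vw] fin by simp
    \<comment> \<open>For y < a, \<open>same\<close> makes the east and diagonal terms equal (both 0
      if x = b), leaving the north term 1. For y = a one has x < b, and \<open>top\<close> leaves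
      the east term 1.\<close>
    moreover have "signed_count (paths_in ?A (real b, real a) (real x, real y)) = 1"
      using signed_count_step[OF vw fin] N E D same top less.prems False by auto
    ultimately show ?thesis by blast
  qed
qed

section \<open>From the signed count to the alternating series\<close>

lemma schroeder_paths_eq:
  "{p. schroeder_path q p} = paths_in (region_above q) (endpoint q) 0"
  by (auto simp: schroeder_path_def paths_in_def weakly_above_def region_above_def)

text \<open>Only finitely many diagonal counts are attained and all other terms vanish, so the
  series is a finite sum; it groups the signed count by the number of diagonal steps.\<close>

lemma sums_signed_sch:
  "(\<lambda>i. (-1) ^ i * int (sch q i)) sums signed_count {p. schroeder_path q p}"
proof -
  let ?S = "{p. schroeder_path q p}"
  let ?I = "(\<lambda>p. count_list p Diagonal) ` ?S"
  have "(-1) ^ i * int (sch q i) = 0" if "i \<notin> ?I" for i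
  proof -
    have "{p. schroeder_path q p \<and> count_list p Diagonal = i} = {}" using that by auto
    then show ?thesis unfolding sch_def by (simp only: card.empty)
  qed
  then have "(\<lambda>i. (-1) ^ i * int (sch q i)) sums (\<Sum>i\<in>?I. (-1) ^ i * int (sch q i))"
    by (intro sums_finite) (auto simp: finite_schroeder_paths)
  also have "(\<Sum>i\<in>?I. (-1) ^ i * int (sch q i)) = signed_count ?S"
    unfolding signed_count_def
    by (subst sum.image_gen[OF finite_schroeder_paths, of _ _ "\<lambda>p. count_list p Diagonal"])
       (simp add: sch_def mult.commute)
  finally show ?thesis .
qed

theorem corollary2p8:
  fixes \<nu> :: "step list" and a b :: nat
  assumes "lattice_path (b, a) \<nu>"
  shows "(\<lambda>i. (-1) ^ i * int (sch \<nu> i)) sums 1"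
proof -
  have "(real 0, real 0) \<in> region_above \<nu>"
    using zero_in_curve[of \<nu>] by (auto simp: region_above_def zero_prod_def)
  then have "signed_count {p. schroeder_path \<nu> p} = 1"
    using signed_count_paths_in[OF assms, of 0 0] endpoint_lattice_path[OF assms]
    by (simp add: schroeder_paths_eq zero_prod_def)
  then show ?thesis using sums_signed_sch[of \<nu>] by simp
qed

end
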